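(* Let $d \in \mathbb{N}$, $c \in (0,\infty)$, $\alpha \in (0,1]$, $F \in C^{1}(\mathbb{R}^{d},\mathbb{R})$, let $\|\cdot\| \colon \mathbb{R}^{d} \to [0,\infty)$ be a norm, let $\gamma \colon \mathbb{N}_{0} \to (0,\infty)$ satisfy $\limsup_{n\to\infty} \gamma_{n} = 0$, and let $C \subseteq \mathbb{R}^{d}$ be convex. Assume for all $x,y \in C$ that $$(F'(x) - F'(y))(x-y) \leq c\,\|x-y\|^{1+\alpha}.$$ Assume that $\sum_{n=0}^{\infty} \mathbf{1}_{(0,1)}(\alpha)\, \gamma_{n}^{\frac{1+\alpha}{1-\alpha}} < \infty$ (i.e., if $\alpha<1$ then $\sum_{n=0}^{\infty} \gamma_{n}^{\frac{1+\alpha}{1-\alpha}} < \infty$, and no condition is imposed if $\alpha=1$). Let $x \colon \mathbb{N}_{0} \to C$ be a sequence, assume $\inf_{n \in \mathbb{N}_{0}} F(x_{n}) > -\infty$, and assume for all $n \in \mathbb{N}_{0}$ that $$x_{n+1} = x_{n} - \gamma_{n} \nabla F(x_{n}).$$ Then: (i) $(F(x_{n}))_{n\in\mathbb{N}_{0}}$ converges in $\mathbb{R}$; and (ii) $\sum_{n=0}^{\infty} \gamma_{n} \|\nabla F(x_{n})\|^{2} < \infty$.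
   Context: $\mathbb{N}=\{1,2,3,\dots\}$ and $\mathbb{N}_{0}=\{0,1,2,\dots\}$. $C^{1}(\mathbb{R}^{d},\mathbb{R})$ denotes the set of continuously differentiable functions from $\mathbb{R}^d$ to $\mathbb{R}$. $F'(x)$ denotes the (Fréchet) derivative of $F$ at $x$, a linear map $\mathbb{R}^{d}\to\mathbb{R}$, so $(F'(x)-F'(y))(x-y)$ is the linear functional $F'(x)-F'(y)$ applied to the vector $x-y$. $\nabla F$ denotes the usual gradient with respect to the standard Euclidean inner product (the vector of partial derivatives), so that $F'(x)v = \langle \nabla F(x), v\rangle$ for $v\in\mathbb{R}^d$. $\mathbf{1}_{(0,1)}$ is the indicator function of the interval $(0,1)$; for $\alpha=1$ the summands $\mathbf{1}_{(0,1)}(\alpha)\gamma_{n}^{\frac{1+\alpha}{1-\alpha}}$ are understood to be $0$. *)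

theory Defs
  imports "HOL-Analysis.Analysis"
begin

text \<open>An arbitrary norm on a real vector space, as opposed to the norm of the type class.\<close>

definition is_norm :: "('v::real_vector \<Rightarrow> real) \<Rightarrow> bool" where
  "is_norm N \<longleftrightarrow>
     (\<forall>v. 0 \<le> N v) \<and>
     (\<forall>v. N v = 0 \<longleftrightarrow> v = 0) \<and>
     (\<forall>r v. N (r *\<^sub>R v) = \<bar>r\<bar> * N v) \<and>
     (\<forall>v w. N (v + w) \<le> N v + N w)"

text \<open>Continuity of the derivative is with respect to the operator norm.\<close>

definition continuously_differentiable ::
  "('v::real_normed_vector \<Rightarrow> 'w::real_normed_vector) \<Rightarrow> bool" where
  "continuously_differentiable F \<longleftrightarrow>
     (\<exists>F' :: 'v \<Rightarrow> ('v \<Rightarrow>\<^sub>L 'w).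
        (\<forall>x. (F has_derivative blinfun_apply (F' x)) (at x)) \<and> continuous_on UNIV F')"

definition partial_deriv :: "'n::finite \<Rightarrow> (real ^ 'n \<Rightarrow> real) \<Rightarrow> real ^ 'n \<Rightarrow> real" where
  "partial_deriv i F x = deriv (\<lambda>t. F (x + t *\<^sub>R axis i 1)) 0"

definition grad :: "(real ^ 'n::finite \<Rightarrow> real) \<Rightarrow> real ^ 'n \<Rightarrow> real ^ 'n" where
  "grad F x = (\<chi> i. partial_deriv i F x)"

lemma partial_deriv_eq:
  assumes "(F has_derivative F') (at x)"
  shows "partial_deriv i F x = F' (axis i 1)"
proof -
  have 1: "((\<lambda>t::real. x + t *\<^sub>R axis i 1) has_derivative (\<lambda>t. t *\<^sub>R axis i 1)) (at 0)"
    by (auto intro!: derivative_eq_intros)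
  have 2: "(F has_derivative F') (at (x + 0 *\<^sub>R axis i 1))"
    using assms by simp
  have "((\<lambda>t. F (x + t *\<^sub>R axis i 1)) has_derivative (\<lambda>t. F' (t *\<^sub>R axis i 1))) (at 0)"
    by (rule has_derivative_compose[OF 1 2])
  moreover have "(\<lambda>t. F' (t *\<^sub>R axis i 1)) = (\<lambda>t. F' (axis i 1) * t)"
    using has_derivative_linear[OF assms] by (simp add: linear_cmul mult.commute)
  ultimately show ?thesis
    unfolding partial_deriv_def by (intro DERIV_imp_deriv) (simp add: has_field_derivative_def)
qed

lemma GDERIV_grad:
  assumes "F differentiable (at x)"
  shows "GDERIV F x :> grad F x"
proof -
  obtain F' where F': "(F has_derivative F') (at x)"
    using assms by (auto simp: differentiable_def)
  interpret linear F'
    using F' by (rule has_derivative_linear)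
  have "F' h = h \<bullet> grad F x" for h
  proof -
    have "F' h = F' (\<Sum>i\<in>UNIV. h $ i *\<^sub>R axis i 1)"
      by (simp add: basis_expansion scalar_mult_eq_scaleR[symmetric])
    also have "\<dots> = (\<Sum>i\<in>UNIV. h $ i * F' (axis i 1))"
      by (simp add: sum scaleR)
    also have "\<dots> = h \<bullet> grad F x"
      by (simp add: inner_vec_def grad_def partial_deriv_eq[OF F'])
    finally show ?thesis .
  qed
  then have "F' = (\<lambda>h. h \<bullet> grad F x)"
    by (rule ext)
  with F' show ?thesis
    by (simp add: gderiv_def)
qed

end

theory Submission
  imports Defs
begin

text \<open>
  By the mean value theorem along a segment in \<open>C\<close>, the one-sided Hoelder condition yields the
  descent estimate \<open>F (x (n + 1)) \<le> F (x n) - \<gamma> n |g|\<^sup>2 + M (\<gamma> n |g|) powr (1 + \<alpha>)\<close> with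
  \<open>g = grad F (x n)\<close>.  The last term is at most half of \<open>\<gamma> n |g|\<^sup>2\<close> up to a summable error: for
  \<open>\<alpha> = 1\<close> because \<open>\<gamma>\<close> tends to \<open>0\<close>, and for \<open>\<alpha> < 1\<close> because, where it is larger, \<open>|g|\<close> is bounded
  by a multiple of \<open>\<gamma> n powr (\<alpha> / (1 - \<alpha>))\<close>.  A sequence that is bounded below and decreases up to
  a summable error converges, and its decrements are summable.
\<close>

text \<open>Subtracting from \<open>a\<close> the partial sums of \<open>e\<close> leaves a sequence
  that is eventually decreasing and bounded below, hence convergent, and adding the convergent
  partial sums back keeps convergence. Then \<open>b\<close> is eventually dominated by a
  telescoping term plus \<open>e\<close>.\<close>

lemma convergent_and_summable_if_decreasing_up_to_summable:
  fixes a b e :: "nat \<Rightarrow> real"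
  assumes step: "eventually (\<lambda>n. a (Suc n) + b n \<le> a n + e n) sequentially"
    and b: "\<And>n. 0 \<le> b n"
    and e: "summable e"
    and L: "\<And>n. L \<le> a n"
  shows "convergent a" and "summable b"
proof -
  obtain m where m: "\<And>n. m \<le> n \<Longrightarrow> a (Suc n) + b n \<le> a n + e n"
    using step by (auto simp: eventually_sequentially)
  define E where "E n = (\<Sum>k<n. e k)" for n
  have E: "convergent E"
    using e unfolding E_def by (simp add: summable_iff_convergent)
  then obtain B where B: "\<And>n. \<bar>E n\<bar> \<le> B"
    by (metis convergent_imp_Bseq BseqE real_norm_def)
  \<comment> \<open>The shift by \<open>m\<close> skips the finitely many indices at which the
    inequality may fail.\<close>
  have "decseq (\<lambda>n. a (n + m) - E (n + m))"
  proof (rule decseq_SucI)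
    fix n
    show "a (Suc n + m) - E (Suc n + m) \<le> a (n + m) - E (n + m)"
      using m[of "n + m"] b[of "n + m"] by (simp add: E_def)
  qed
  moreover have "L - B \<le> a (n + m) - E (n + m)" for n
    using L[of "n + m"] B[of "n + m"] by linarith
  ultimately obtain l where "(\<lambda>n. a (n + m) - E (n + m)) \<longlonglongrightarrow> l"
    using decseq_convergent by blast
  then have "convergent (\<lambda>n. a n - E n)"
    using convergent_ignore_initial_segment[of "\<lambda>n. a n - E n" m] by (auto simp: convergent_def)
  from convergent_add[OF this E] show a: "convergent a"
    by simp
  then obtain l where "a \<longlonglongrightarrow> l"
    by (auto simp: convergent_def)
  then have "summable (\<lambda>n. a n - a (Suc n))"
    by (rule telescope_summable')
  then have "summable (\<lambda>n. a n - a (Suc n) + e n)"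
    using e by (rule summable_add)
  then show "summable b"
  proof (rule summable_comparison_test')
    show "norm (b n) \<le> a n - a (Suc n) + e n" if "m \<le> n" for n
      using m[OF that] b[of n] by simp
  qed
qed

text \<open>Expand \<open>v\<close> in the standard basis: by the triangle inequality and
  homogeneity \<open>N v\<close> is at most a combination of the values \<open>N b\<close>, with
  coordinates bounded by \<open>norm v\<close>.\<close>

lemma is_norm_le_norm:
  fixes N :: "'v::euclidean_space \<Rightarrow> real"
  assumes N: "is_norm N"
  obtains K where "0 < K" and "\<And>v. N v \<le> K * norm v"
proof
  have nonneg: "0 \<le> N v" for v
    using N by (simp add: is_norm_def)
  \<comment> \<open>The added 1 makes positivity of the constant immediate.\<close>
  show "0 < (\<Sum>b\<in>Basis. N b) + 1"
    by (simp add: add_nonneg_pos sum_nonneg nonneg)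
  show "N v \<le> ((\<Sum>b\<in>Basis. N b) + 1) * norm v" for v
  proof -
    have N_sum: "N (sum f A) \<le> (\<Sum>i\<in>A. N (f i))" if "finite A" for f :: "'v \<Rightarrow> 'v" and A
      using that
    proof (induction A rule: finite_induct)
      case empty
      have "N 0 = 0"
        using N by (simp add: is_norm_def)
      then show ?case
        by simp
    next
      case (insert i A)
      have "N (f i + sum f A) \<le> N (f i) + N (sum f A)"
        using N by (simp add: is_norm_def)
      with insert show ?case
        by simp
    qed
    have "N v = N (\<Sum>b\<in>Basis. (v \<bullet> b) *\<^sub>R b)"
      by (simp add: euclidean_representation)
    also have "\<dots> \<le> (\<Sum>b\<in>Basis. N ((v \<bullet> b) *\<^sub>R b))"
      by (rule N_sum) simp
    also have "\<dots> = (\<Sum>b\<in>Basis. \<bar>v \<bullet> b\<bar> * N b)"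
      using N by (simp add: is_norm_def)
    also have "\<dots> \<le> (\<Sum>b\<in>Basis. norm v * N b)"
      by (intro sum_mono mult_right_mono Basis_le_norm nonneg)
    also have "\<dots> = (\<Sum>b\<in>Basis. N b) * norm v"
      by (simp add: sum_distrib_left mult.commute)
    also have "\<dots> \<le> ((\<Sum>b\<in>Basis. N b) + 1) * norm v"
      by (intro mult_right_mono) auto
    finally show ?thesis .
  qed
qed

text \<open>The mean value theorem writes the increment as the derivative at some
  \<open>u + t *\<^sub>R h\<close>, applied to \<open>h\<close>. The hypothesis compares derivatives
  only along the difference of their base points, here \<open>t *\<^sub>R h\<close>, so by linearity
  the comparison along \<open>h\<close> follows after division by \<open>t\<close>.\<close>

lemma increment_le_of_one_sided_Hoelder_derivative:
  fixes F :: "'v::real_normed_vector \<Rightarrow> real"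
  assumes diff: "\<And>w. w \<in> C \<Longrightarrow> F differentiable (at w)"
    and C: "convex C" "u \<in> C" "v \<in> C"
    and N: "is_norm N"
    and c: "0 \<le> c" and \<alpha>: "0 \<le> \<alpha>"
    and hoelder: "\<And>w z. w \<in> C \<Longrightarrow> z \<in> C \<Longrightarrow>
           frechet_derivative F (at w) (w - z) - frechet_derivative F (at z) (w - z)
             \<le> c * N (w - z) powr (1 + \<alpha>)"
  shows "F v - F u \<le> frechet_derivative F (at u) (v - u) + c * N (v - u) powr (1 + \<alpha>)"
proof -
  define h where "h = v - u"
  define D where "D w = frechet_derivative F (at w)" for w
  have in_C: "u + t *\<^sub>R h \<in> C" if "0 \<le> t" "t \<le> 1" for t
    using convexD_alt[OF C that] by (simp add: h_def algebra_simps)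
  have D: "(F has_derivative D w) (at w)" if "w \<in> C" for w
    using diff[OF that] by (simp add: D_def frechet_derivative_works)
  have deriv: "((\<lambda>t. F (u + t *\<^sub>R h)) has_derivative (\<lambda>s. D (u + t *\<^sub>R h) (s *\<^sub>R h))) (at t)"
    if "0 \<le> t" "t \<le> 1" for t
  proof -
    have "((\<lambda>t. u + t *\<^sub>R h) has_derivative (\<lambda>s. s *\<^sub>R h)) (at t)"
      by (auto intro!: derivative_eq_intros)
    from has_derivative_compose[OF this D[OF in_C[OF that]]] show ?thesis .
  qed
  have "continuous_on {0..1} (\<lambda>t. F (u + t *\<^sub>R h))"
    by (rule has_derivative_continuous_on, rule has_derivative_at_withinI, rule deriv) auto
  then obtain t where t: "0 < t" "t < 1"
    and mvt: "F (u + 1 *\<^sub>R h) - F (u + 0 *\<^sub>R h) = D (u + t *\<^sub>R h) ((1 - 0) *\<^sub>R h)"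
    using mvt[of 0 1 "\<lambda>t. F (u + t *\<^sub>R h)" "\<lambda>t s. D (u + t *\<^sub>R h) (s *\<^sub>R h)"] deriv
    by (metis less_eq_real_def zero_less_one)
  have w: "u + t *\<^sub>R h \<in> C"
    using t by (intro in_C) auto
  have N_nonneg: "0 \<le> N h"
    using N by (simp add: is_norm_def)
  have lin: "D z (t *\<^sub>R h) = t * D z h" if "z \<in> C" for z
    using linear_cmul[OF has_derivative_linear[OF D[OF that]]] by simp
  have "D (u + t *\<^sub>R h) (t *\<^sub>R h) - D u (t *\<^sub>R h) \<le> c * N (t *\<^sub>R h) powr (1 + \<alpha>)"
    using hoelder[OF w C(2)] by (simp add: D_def)
  also have "N (t *\<^sub>R h) = t * N h"
    using N t by (simp add: is_norm_def)
  also have "(t * N h) powr (1 + \<alpha>) = t powr (1 + \<alpha>) * N h powr (1 + \<alpha>)"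
    using t N_nonneg by (simp add: powr_mult)
  \<comment> \<open>Since \<open>t powr \<alpha> \<le> 1\<close>, this factor is dropped; the
    remaining \<open>t\<close> cancels the one on the left.\<close>
  also have "c * (t powr (1 + \<alpha>) * N h powr (1 + \<alpha>)) \<le> c * (t * N h powr (1 + \<alpha>))"
    using c t \<alpha> powr_le1[of \<alpha> t]
    by (intro mult_left_mono mult_right_mono) (auto simp: powr_add mult_left_le)
  finally have "t * (D (u + t *\<^sub>R h) h - D u h) \<le> t * (c * N h powr (1 + \<alpha>))"
    by (simp add: lin[OF w] lin[OF C(2)] algebra_simps)
  with t have "D (u + t *\<^sub>R h) h - D u h \<le> c * N h powr (1 + \<alpha>)"
    by simp
  with mvt show ?thesis
    by (simp add: h_def D_def)
qed

text \<open>If the first summand on the right does not suffice, then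
  \<open>(s * g) powr (1 - \<alpha>) \<le> 2 * M * s\<close>. Raising this to the power
  \<open>(1 + \<alpha>) / (1 - \<alpha>)\<close> bounds the left side by the second summand
  alone.\<close>

lemma powr_absorb_half:
  fixes s g \<alpha> M :: real
  assumes s: "0 < s" and g: "0 \<le> g" and \<alpha>: "0 < \<alpha>" "\<alpha> < 1" and M: "0 \<le> M"
  shows "M * (s * g) powr (1 + \<alpha>)
    \<le> s * g\<^sup>2 / 2 + M * (2 * M) powr ((1 + \<alpha>) / (1 - \<alpha>)) * s powr ((1 + \<alpha>) / (1 - \<alpha>))"
proof (cases "M * (s * g) powr (1 + \<alpha>) \<le> s * g\<^sup>2 / 2")
  case True
  then show ?thesis
    using M by (simp add: add_increasing2)
next
  case False
  then have "g \<noteq> 0"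
    by auto
  with g have g: "0 < g"
    by simp
  \<comment> \<open>Factoring \<open>(s * g) powr (1 + \<alpha>)\<close> out of
    \<open>s * g\<^sup>2\<close> lets it be cancelled from the negated case inequality.\<close>
  have "s powr (- \<alpha>) * g powr (1 - \<alpha>) * (s * g) powr (1 + \<alpha>) = s * g\<^sup>2"
  proof -
    have "s powr (- \<alpha>) * g powr (1 - \<alpha>) * (s * g) powr (1 + \<alpha>)
      = (s powr (- \<alpha>) * s powr (1 + \<alpha>)) * (g powr (1 - \<alpha>) * g powr (1 + \<alpha>))"
      using s g by (simp add: powr_mult)
    also have "\<dots> = s * g\<^sup>2"
      using s g by (simp add: powr_add[symmetric])
    finally show ?thesis .
  qed
  with False have "s powr (- \<alpha>) * g powr (1 - \<alpha>) * (s * g) powr (1 + \<alpha>)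
      < 2 * M * (s * g) powr (1 + \<alpha>)"
    by simp
  then have "s powr (- \<alpha>) * g powr (1 - \<alpha>) < 2 * M"
    using s g by simp
  then have "s * (s powr (- \<alpha>) * g powr (1 - \<alpha>)) \<le> s * (2 * M)"
    using s by simp
  moreover have "s * (s powr (- \<alpha>) * g powr (1 - \<alpha>)) = (s * g) powr (1 - \<alpha>)"
    using s g powr_mult_base[of s "- \<alpha>"] by (simp add: powr_mult)
  ultimately have "(s * g) powr (1 - \<alpha>) \<le> 2 * M * s"
    by (simp add: mult_ac)
  then have "((s * g) powr (1 - \<alpha>)) powr ((1 + \<alpha>) / (1 - \<alpha>))
      \<le> (2 * M * s) powr ((1 + \<alpha>) / (1 - \<alpha>))"
    using \<alpha> by (intro powr_mono2) auto
  then have "(s * g) powr (1 + \<alpha>) \<le> (2 * M) powr ((1 + \<alpha>) / (1 - \<alpha>)) * s powr ((1 + \<alpha>) / (1 - \<alpha>))"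
    using \<alpha> s g M by (simp add: powr_powr powr_mult)
  from mult_left_mono[OF this M] show ?thesis
    using s by (simp add: add_increasing mult.assoc)
qed

theorem theorem3:
  fixes c \<alpha> :: real
    and F :: "real ^ 'd \<Rightarrow> real"
    and N :: "real ^ 'd \<Rightarrow> real"
    and \<gamma> :: "nat \<Rightarrow> real"
    and C :: "(real ^ 'd) set"
    and x :: "nat \<Rightarrow> real ^ 'd"
  assumes "0 < c"
    and "0 < \<alpha>" and "\<alpha> \<le> 1"
    and "continuously_differentiable F"
    and "is_norm N"
    and "\<And>n. 0 < \<gamma> n"
    and "limsup (\<lambda>n. ereal (\<gamma> n)) = 0"
    and "convex C"
    and "\<And>u v. u \<in> C \<Longrightarrow> v \<in> C \<Longrightarrow>
           frechet_derivative F (at u) (u - v) - frechet_derivative F (at v) (u - v)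
             \<le> c * N (u - v) powr (1 + \<alpha>)"
    and "summable (\<lambda>n. indicator {0<..<1} \<alpha> * \<gamma> n powr ((1 + \<alpha>) / (1 - \<alpha>)))"
    and "\<And>n. x n \<in> C"
    and "(INF n. ereal (F (x n))) > - \<infinity>"
    and "\<And>n. x (Suc n) = x n - \<gamma> n *\<^sub>R grad F (x n)"
  shows "convergent (\<lambda>n. F (x n)) \<and>
         summable (\<lambda>n. \<gamma> n * (N (grad F (x n)))\<^sup>2)"
proof -
  note c = assms(1) and \<alpha> = assms(2,3) and C1 = assms(4) and N = assms(5) and \<gamma> = assms(6)
  \<comment> \<open>The Euclidean norm is the one for which a gradient step changes \<open>F\<close>
    to first order by exactly \<open>- \<gamma> n * (g n)\<^sup>2\<close>; \<open>N\<close> is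
    compared with it only through \<open>K\<close>.\<close>
  define g where "g n = norm (grad F (x n))" for n
  have N_nonneg: "0 \<le> N v" for v
    using N by (simp add: is_norm_def)
  have diff: "F differentiable (at w)" for w
    using C1 by (auto simp: continuously_differentiable_def differentiable_def)
  have D: "frechet_derivative F (at w) h = h \<bullet> grad F w" for w h
    using GDERIV_grad[OF diff] frechet_derivative_at unfolding gderiv_def by metis
  obtain K where K: "0 < K" "\<And>v. N v \<le> K * norm v"
    using is_norm_le_norm[OF N] by metis
  define M where "M = c * K powr (1 + \<alpha>)"
  have M: "0 < M"
    using c K by (simp add: M_def)
  have descent: "F (x (Suc n)) + \<gamma> n * (g n)\<^sup>2 \<le> F (x n) + M * (\<gamma> n * g n) powr (1 + \<alpha>)" for n
  proof -
    define h where "h = x (Suc n) - x n"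
    have h: "h = - (\<gamma> n *\<^sub>R grad F (x n))"
      by (simp add: h_def assms(13))
    have "F (x (Suc n)) - F (x n)
        \<le> frechet_derivative F (at (x n)) h + c * N h powr (1 + \<alpha>)"
      unfolding h_def using diff assms(8,9,11) N c \<alpha>
      by (intro increment_le_of_one_sided_Hoelder_derivative[where C = C]) auto
    also have "frechet_derivative F (at (x n)) h = - (\<gamma> n * (g n)\<^sup>2)"
      by (simp add: D h g_def power2_norm_eq_inner)
    also have "c * N h powr (1 + \<alpha>) \<le> c * (K * norm h) powr (1 + \<alpha>)"
      using c \<alpha> K(2) N_nonneg by (intro mult_left_mono powr_mono2) auto
    also have "c * (K * norm h) powr (1 + \<alpha>) = M * (\<gamma> n * g n) powr (1 + \<alpha>)"
      using K(1) \<gamma>[of n] by (simp add: h g_def M_def powr_mult)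
    finally show ?thesis
      by simp
  qed
  obtain e where e: "summable e"
    and absorb: "eventually (\<lambda>n. M * (\<gamma> n * g n) powr (1 + \<alpha>) \<le> \<gamma> n * (g n)\<^sup>2 / 2 + e n) sequentially"
  proof (cases "\<alpha> < 1")
    case True
    let ?p = "(1 + \<alpha>) / (1 - \<alpha>)"
    \<comment> \<open>For these \<alpha> the indicator is 1, so the hypothesis gives summability of
      the powers themselves.\<close>
    have "summable (\<lambda>n. M * (2 * M) powr ?p * \<gamma> n powr ?p)"
      using assms(10) True \<alpha> by (intro summable_mult) simp
    moreover have "M * (\<gamma> n * g n) powr (1 + \<alpha>)
        \<le> \<gamma> n * (g n)\<^sup>2 / 2 + M * (2 * M) powr ?p * \<gamma> n powr ?p" for n
      using True \<alpha> M by (intro powr_absorb_half \<gamma>) (auto simp: g_def)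
    ultimately show ?thesis
      by (intro that always_eventually allI)
  next
    case False
    with \<alpha> have \<alpha>: "\<alpha> = 1"
      by simp
    \<comment> \<open>Below this threshold \<open>M * \<gamma> n \<le> 1 / 2\<close>, so the
      quadratic remainder is at most half of the decrease and the error can be taken to be
      0.\<close>
    have "eventually (\<lambda>n. ereal (\<gamma> n) < ereal (1 / (2 * M))) sequentially"
      using M assms(7) by (intro Limsup_lessD) (simp add: zero_ereal_def)
    then have "eventually (\<lambda>n. M * (\<gamma> n * g n) powr (1 + \<alpha>) \<le> \<gamma> n * (g n)\<^sup>2 / 2 + 0) sequentially"
    proof eventually_elim
      case (elim n)
      then have "M * \<gamma> n \<le> 1 / 2"
        using M by (simp add: field_simps)
      then have "(M * \<gamma> n) * (\<gamma> n * (g n)\<^sup>2) \<le> 1 / 2 * (\<gamma> n * (g n)\<^sup>2)"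
        using \<gamma>[of n] by (intro mult_right_mono) auto
      moreover have "(\<gamma> n * g n) powr (1 + \<alpha>) = (\<gamma> n * g n)\<^sup>2"
        using \<gamma>[of n] by (simp add: \<alpha> g_def)
      ultimately show ?case
        by (simp add: power2_eq_square mult_ac)
    qed
    then show ?thesis
      by (intro that[of "\<lambda>_. 0"]) auto
  qed
  have step: "eventually (\<lambda>n. F (x (Suc n)) + \<gamma> n * (g n)\<^sup>2 / 2 \<le> F (x n) + e n) sequentially"
    using absorb
  proof eventually_elim
    case (elim n)
    then show ?case
      using descent[of n] by linarith
  qed
  \<comment> \<open>A real lower bound is chosen strictly between minus infinity and the extended
    real infimum.\<close>
  obtain L where "ereal L < (INF n. ereal (F (x n)))"
    using assms(12) ereal_dense2[of "- \<infinity>" "INF n. ereal (F (x n))"] by auto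
  then have L: "L \<le> F (x n)" for n
    by (metis INF_lower UNIV_I less_le_trans ereal_less_eq(3) less_imp_le)
  have nonneg: "0 \<le> \<gamma> n * (g n)\<^sup>2 / 2" for n
    using \<gamma>[of n] by simp
  note Lyapunov = convergent_and_summable_if_decreasing_up_to_summable[OF step nonneg e L]
  have "summable (\<lambda>n. \<gamma> n * (N (grad F (x n)))\<^sup>2)"
  proof (rule summable_comparison_test')
    \<comment> \<open>The factor 2 undoes the halving in \<open>step\<close>, and
      \<open>K\<^sup>2\<close> pays for passing from the Euclidean norm to \<open>N\<close>.\<close>
    show "summable (\<lambda>n. 2 * K\<^sup>2 * (\<gamma> n * (g n)\<^sup>2 / 2))"
      by (rule summable_mult[OF Lyapunov(2)])
    show "norm (\<gamma> n * (N (grad F (x n)))\<^sup>2) \<le> 2 * K\<^sup>2 * (\<gamma> n * (g n)\<^sup>2 / 2)" for n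
    proof -
      have "(N (grad F (x n)))\<^sup>2 \<le> (K * g n)\<^sup>2"
        unfolding g_def by (intro power_mono K(2) N_nonneg)
      from mult_left_mono[OF this, of "\<gamma> n"] show ?thesis
        using \<gamma>[of n] by (simp add: power_mult_distrib mult_ac)
    qed
  qed
  with Lyapunov(1) show ?thesis
    by blast
qed

end
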